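(* Let $C$ be an irreducible quadratic curve in $\mathbb{R}^2$ defined by $a_{11}x^2+a_{22}y^2+2a_{12}xy+2a_1x+2a_2y+c=0$ (real coefficients), and let $$G_1[C](x,y)=(a_{12}^2-a_{11}a_{22})(x^2+y^2)^2+2(a_{12}a_2-a_1a_{22})(x^2+y^2)x+2(a_1a_{12}-a_2a_{11})(x^2+y^2)y+(a_2^2-a_{22}c)x^2+2(a_{12}c-a_1a_2)xy+(a_1^2-a_{11}c)y^2 .$$ Then the pedal $\mathrm{Pe}_C$ of $C$ is $$\mathrm{Pe}_C=\{(x,y)\in\mathbb{R}^2\mid G_1[C](x,y)=0\}.$$ Therefore $\mathrm{Pe}_C$ is a cubic or quartic curve through the origin, including the case when the origin is an isolated point of $\mathrm{Pe}_C$.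
   Context: The quadratic curve $C$ is called reducible if there exist lines $\ell_1,\ell_2$ (possibly $\ell_1=\ell_2$) such that $C=\ell_1\cup\ell_2$, and irreducible if it is not reducible; irreducibility is taken to be equivalent to $\Delta\neq 0$, where $\Delta=\det\begin{pmatrix} a_{11} & a_{12} & a_1 \\ a_{12} & a_{22} & a_2 \\ a_1 & a_2 & c \end{pmatrix}$. For $(x_0,y_0)\in C$, the tangent line of $C$ at $(x_0,y_0)$ is $\ell:\ (a_1+a_{11}x_0+a_{12}y_0)x+(a_2+a_{12}x_0+a_{22}y_0)y+c+a_1x_0+a_2y_0=0$, and $L$ denotes the line through the origin orthogonal to $\ell$. The pedal $\mathrm{Pe}_C$ of $C$ (with respect to the origin) is the locus of the intersection points $\ell\cap L$ as $(x_0,y_0)$ runs over $C$, that is, of the points $(x,y)=\frac{-c-a_1x_0-a_2y_0}{(a_1+a_{11}x_0+a_{12}y_0)^2+(a_2+a_{12}x_0+a_{22}y_0)^2}\,(a_1+a_{11}x_0+a_{12}y_0,\ a_2+a_{12}x_0+a_{22}y_0)$.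
   Formalization: The pedal is taken as the closure of the locus with the origin added, since the literal equality fails (for x²+y²=1 the origin, for (x−1)(y−1)=1 the point (1,0)); it is also proved that {G1=0} is the literal locus together with the origin and the feet of the asymptotes. *)

theory Defs
  imports "HOL-Analysis.Analysis"
begin

text \<open>
  A quadratic curve is represented by the coefficients of its equation, in the order
  \<open>a11 a22 a12 a1 a2 c\<close>, and not by its point set: the discriminant, the tangent lines and the
  polynomial \<open>G1\<close> are functions of the equation.
\<close>

definition conic :: "real \<Rightarrow> real \<Rightarrow> real \<Rightarrow> real \<Rightarrow> real \<Rightarrow> real \<Rightarrow> (real \<times> real) set" where
  "conic a11 a22 a12 a1 a2 c =
     {(x, y). a11 * x^2 + a22 * y^2 + 2 * a12 * x * y + 2 * a1 * x + 2 * a2 * y + c = 0}"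

definition conic_disc :: "real \<Rightarrow> real \<Rightarrow> real \<Rightarrow> real \<Rightarrow> real \<Rightarrow> real \<Rightarrow> real" where
  "conic_disc a11 a22 a12 a1 a2 c =
     det (vector [vector [a11, a12, a1], vector [a12, a22, a2], vector [a1, a2, c]] :: real^3^3)"

text \<open>
  Irreducibility is nonvanishing of the discriminant. It implies that the real point set is not a
  union of two lines (see \<open>irreducible_conic_not_union_of_lines\<close>). The converse fails for
  degenerate equations with too few real points, such as \<open>x\<^sup>2 + 1 = 0\<close>, whose curve has
  to count as reducible. A nonzero discriminant also forces \<open>(a11, a12, a22) \<noteq> 0\<close>.
\<close>

definition irreducible_conic :: "real \<Rightarrow> real \<Rightarrow> real \<Rightarrow> real \<Rightarrow> real \<Rightarrow> real \<Rightarrow> bool" where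
  "irreducible_conic a11 a22 a12 a1 a2 c \<longleftrightarrow> conic_disc a11 a22 a12 a1 a2 c \<noteq> 0"

definition line :: "real \<Rightarrow> real \<Rightarrow> real \<Rightarrow> (real \<times> real) set" where
  "line u v w = {(x, y). u * x + v * y + w = 0}"

text \<open>
  For \<open>(u, v) \<noteq> 0\<close> the second factor is the line through the origin orthogonal to
  \<open>line u v w\<close>, so that \<open>feet u v w\<close> consists of the foot of the perpendicular from the origin.
  If \<open>(u, v) = 0\<close> and \<open>w \<noteq> 0\<close> then \<open>feet u v w\<close> is empty.
\<close>

definition feet :: "real \<Rightarrow> real \<Rightarrow> real \<Rightarrow> (real \<times> real) set" where
  "feet u v w = line u v w \<inter> range (\<lambda>t. (t * u, t * v))"

definition pedal_locus :: "real \<Rightarrow> real \<Rightarrow> real \<Rightarrow> real \<Rightarrow> real \<Rightarrow> real \<Rightarrow> (real \<times> real) set" where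
  "pedal_locus a11 a22 a12 a1 a2 c =
     (\<Union>(x0, y0) \<in> conic a11 a22 a12 a1 a2 c.
        feet (a1 + a11 * x0 + a12 * y0) (a2 + a12 * x0 + a22 * y0) (c + a1 * x0 + a2 * y0))"

text \<open>
  The zero set of \<open>G1\<close> always contains the origin, which need not lie on the locus itself: for the
  unit circle the locus is the circle, and the origin is an isolated zero of \<open>G1\<close>. The zero set
  also contains the feet of the asymptotes of a hyperbola, which are limits of feet of tangents:
  for \<open>(x - 1) (y - 1) = 1\<close> these are \<open>(1, 0)\<close> and \<open>(0, 1)\<close>, and neither is on the locus. The
  pedal is therefore the locus completed by its limit points and the origin.
\<close>

definition pedal :: "real \<Rightarrow> real \<Rightarrow> real \<Rightarrow> real \<Rightarrow> real \<Rightarrow> real \<Rightarrow> (real \<times> real) set" where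
  "pedal a11 a22 a12 a1 a2 c = insert (0, 0) (closure (pedal_locus a11 a22 a12 a1 a2 c))"

text \<open>
  An asymptote is the tangent at a real point \<open>(u : v : 0)\<close> at infinity: its coefficients are those
  of the tangent, with the homogeneous coordinates \<open>(x0 : y0 : 1)\<close> replaced by \<open>(u : v : 0)\<close>.
  For an irreducible ellipse there is no such point; for a parabola the tangent there is the line
  at infinity, whose \<open>feet\<close> is empty. So this set is nonempty only for hyperbolas.
\<close>

definition asymptote_feet ::
    "real \<Rightarrow> real \<Rightarrow> real \<Rightarrow> real \<Rightarrow> real \<Rightarrow> (real \<times> real) set" where
  "asymptote_feet a11 a22 a12 a1 a2 =
     (\<Union>(u, v) \<in> {(u, v). (u, v) \<noteq> (0, 0) \<and> a11 * u^2 + a22 * v^2 + 2 * a12 * u * v = 0}.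
        feet (a11 * u + a12 * v) (a12 * u + a22 * v) (a1 * u + a2 * v))"

definition G1 ::
    "real \<Rightarrow> real \<Rightarrow> real \<Rightarrow> real \<Rightarrow> real \<Rightarrow> real \<Rightarrow> real \<Rightarrow> real \<Rightarrow> real" where
  "G1 a11 a22 a12 a1 a2 c x y =
     (a12^2 - a11 * a22) * (x^2 + y^2)^2
     + 2 * (a12 * a2 - a1 * a22) * (x^2 + y^2) * x
     + 2 * (a1 * a12 - a2 * a11) * (x^2 + y^2) * y
     + (a2^2 - a22 * c) * x^2
     + 2 * (a12 * c - a1 * a2) * x * y
     + (a1^2 - a11 * c) * y^2"

text \<open>
  The function \<open>f\<close> is a polynomial in two variables of total degree exactly \<open>d\<close>. Since a real
  polynomial function determines its coefficients, \<open>d\<close> is unique.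
\<close>

definition poly2_of_degree :: "(real \<Rightarrow> real \<Rightarrow> real) \<Rightarrow> nat \<Rightarrow> bool" where
  "poly2_of_degree f d \<longleftrightarrow>
     (\<exists>k :: nat \<Rightarrow> nat \<Rightarrow> real.
        (\<forall>x y. f x y = (\<Sum>i\<le>d. \<Sum>j\<le>d - i. k i j * x^i * y^j)) \<and>
        (\<exists>i\<le>d. k i (d - i) \<noteq> 0))"

lemma conic_disc_eq:
  "conic_disc a11 a22 a12 a1 a2 c =
     a11 * (a22 * c - a2^2) - a12 * (a12 * c - a1 * a2) + a1 * (a12 * a2 - a22 * a1)"
  unfolding conic_disc_def det_3 vector_3 by (simp add: algebra_simps power2_eq_square)

lemma feet_eq:
  assumes "(u, v) \<noteq> (0, 0)"
  shows "feet u v w = {(- w / (u^2 + v^2) * u, - w / (u^2 + v^2) * v)}"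
proof -
  have nz: "u^2 + v^2 \<noteq> 0" using assms by (simp add: sum_power2_eq_zero_iff)
  have *: "(t * u, t * v) \<in> line u v w \<longleftrightarrow> t = - w / (u^2 + v^2)" for t
  proof -
    have "(t * u, t * v) \<in> line u v w \<longleftrightarrow> t * (u^2 + v^2) = - w"
      unfolding line_def by (auto simp: algebra_simps power2_eq_square)
    also have "\<dots> \<longleftrightarrow> t = - w / (u^2 + v^2)"
      by (simp only: nonzero_eq_divide_eq[OF nz])
    finally show ?thesis .
  qed
  have "feet u v w = {(t * u, t * v) | t. (t * u, t * v) \<in> line u v w}"
    unfolding feet_def by blast
  then show ?thesis unfolding * by blast
qed

lemma pedal_locus_eq:
  assumes "irreducible_conic a11 a22 a12 a1 a2 c"
  shows "pedal_locus a11 a22 a12 a1 a2 c =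
    (\<lambda>(x0, y0).
       let u = a1 + a11 * x0 + a12 * y0; v = a2 + a12 * x0 + a22 * y0;
           s = (- c - a1 * x0 - a2 * y0) / (u^2 + v^2)
       in (s * u, s * v)) ` conic a11 a22 a12 a1 a2 c"
proof -
  have nz: "(a1 + a11 * x + a12 * y, a2 + a12 * x + a22 * y) \<noteq> (0, 0)"
    if "(x, y) \<in> conic a11 a22 a12 a1 a2 c" for x y
  proof
    assume "(a1 + a11 * x + a12 * y, a2 + a12 * x + a22 * y) = (0, 0)"
    then have 1: "a1 = - (a11 * x + a12 * y)" and 2: "a2 = - (a12 * x + a22 * y)" by auto
    have 3: "c = a11 * x^2 + a22 * y^2 + 2 * a12 * x * y"
      using that unfolding conic_def 1 2 by (simp add: algebra_simps power2_eq_square)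
    have "conic_disc a11 a22 a12 a1 a2 c = 0"
      unfolding conic_disc_eq 1 2 3 by (simp add: algebra_simps power2_eq_square)
    with assms show False unfolding irreducible_conic_def by simp
  qed
  have pt: "feet (a1 + a11 * x + a12 * y) (a2 + a12 * x + a22 * y) (c + a1 * x + a2 * y) =
      {(let u = a1 + a11 * x + a12 * y; v = a2 + a12 * x + a22 * y;
            s = (- c - a1 * x - a2 * y) / (u^2 + v^2)
        in (s * u, s * v))}" if "(x, y) \<in> conic a11 a22 a12 a1 a2 c" for x y
  proof -
    have "- (c + a1 * x + a2 * y) = - c - a1 * x - a2 * y" by simp
    then show ?thesis unfolding feet_eq[OF nz[OF that]] Let_def by (simp only:)
  qed
  have "(\<Union>z \<in> S. f z) = g ` S" if "\<And>z. z \<in> S \<Longrightarrow> f z = {g z}"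
    for S :: "(real \<times> real) set" and f and g :: "real \<times> real \<Rightarrow> real \<times> real"
    using that by auto
  then show ?thesis
    unfolding pedal_locus_def using pt by (simp add: case_prod_beta)
qed

lemma irreducible_conic_not_union_of_lines:
  assumes "irreducible_conic a11 a22 a12 a1 a2 c" and "(u, v) \<noteq> (0, 0)"
  shows "conic a11 a22 a12 a1 a2 c \<noteq> line u v w \<union> line u' v' w'"
proof
  assume eq: "conic a11 a22 a12 a1 a2 c = line u v w \<union> line u' v' w'"
  have nz: "u^2 + v^2 \<noteq> 0" using assms(2) by (simp add: sum_power2_eq_zero_iff)
  define s where "s = - w / (u^2 + v^2)"
  define p q where "p = s * u" and "q = s * v"
  have "s * (u^2 + v^2) + w = 0" using nz by (simp add: s_def)
  then have "(p - t * v, q + t * u) \<in> line u v w" for t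
    unfolding line_def p_def q_def by (simp add: algebra_simps power2_eq_square)
  then have on: "(p - t * v, q + t * u) \<in> conic a11 a22 a12 a1 a2 c" for t
    using eq by blast
  define A where "A = a11 * p^2 + a22 * q^2 + 2 * a12 * p * q + 2 * a1 * p + 2 * a2 * q + c"
  define B where "B = - a11 * p * v + a12 * (p * u - q * v) + a22 * q * u - a1 * v + a2 * u"
  define D where "D = a11 * v^2 - 2 * a12 * u * v + a22 * u^2"
  have poly: "A + 2 * t * B + t^2 * D = 0" for t
    using on[of t] unfolding conic_def A_def B_def D_def
    by (simp add: algebra_simps power2_eq_square)
  have "A = 0" "B = 0" "D = 0"
    using poly[of 0] poly[of 1] poly[of "-1"] by auto
  define X where "X = p * (a11 * u + a12 * v) + q * (a12 * u + a22 * v) + a1 * u + a2 * v"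
  define Y where "Y = - v * (a11 * u + a12 * v) + u * (a12 * u + a22 * v)"
  define Z where "Z = a11 * u^2 + 2 * a12 * u * v + a22 * v^2"
  have "(u^2 + v^2)^2 * conic_disc a11 a22 a12 a1 a2 c =
      A * (D * Z - Y^2) - B * (B * Z - X * Y) + X * (B * Y - D * X)"
    unfolding conic_disc_eq A_def B_def D_def X_def Y_def Z_def by algebra
  with \<open>A = 0\<close> \<open>B = 0\<close> \<open>D = 0\<close> nz assms(1) show False
    unfolding irreducible_conic_def by simp
qed

end

theory Submission
  imports Defs
begin

text \<open>
  The argument is projective duality. Let \<open>M\<close> be the symmetric matrix of the equation. The tangent
  of the conic at the homogeneous point \<open>P\<close> is the line with coefficient vector \<open>M P\<close>, and, when
  \<open>det M \<noteq> 0\<close>, a line with coefficient vector \<open>L\<close> is a tangent exactly when it satisfies the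
  equation of the dual conic, whose matrix is the adjugate of \<open>M\<close>. A point \<open>(x, y) \<noteq> 0\<close> is the
  foot of the perpendicular from the origin to one line only, namely
  \<open>x X + y Y - (x\<^sup>2 + y\<^sup>2) = 0\<close>, and \<open>- G1 x y\<close> is the dual form evaluated at this line
  (\<open>G1_eq_dual_form\<close>). So the nonzero zeros of \<open>G1\<close> are the nonzero feet of the tangents at all
  points of the projective conic. Its affine points give the locus and its points at infinity give
  the asymptotes, which proves \<open>G1_zero_set\<close>.

  Two facts about limits remain: the feet of the asymptotes are limits of points of the locus, and
  the origin is not isolated in the locus if it belongs to it. Both say that near a point \<open>P\<close> of the
  projective conic there are further points of the conic outside a given line: the line at infinity
  for an asymptote, and, for the origin, its polar, which contains the points of contact of all
  tangents through the origin. \<open>conic_branch\<close> gives such points by an explicit parametrization, and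
  \<open>foot_curve\<close> transports them to the feet, which depend continuously on the point of contact.

  The coefficients of the part of degree four are multiples of \<open>a12\<^sup>2 - a11 a22\<close>. If this number
  vanishes, expanding the determinant along its last column shows that the cubic part is not zero.
\<close>

section \<open>Feet of perpendiculars and quadratic polynomials\<close>

lemma feet_scale:
  assumes "k \<noteq> 0"
  shows "feet (k * u) (k * v) (k * w) = feet u v w"
proof -
  have "line (k * u) (k * v) (k * w) = line u v w"
  proof -
    have "k * u * x + k * v * y + k * w = k * (u * x + v * y + w)" for x y
      by (simp add: algebra_simps)
    with assms show ?thesis unfolding line_def by auto
  qed
  moreover have "range (\<lambda>t. (t * (k * u), t * (k * v))) = range (\<lambda>t. (t * u, t * v))"
  proof -
    have "range (\<lambda>t. (t * (k * u), t * (k * v))) = (\<lambda>t. (t * u, t * v)) ` range (\<lambda>t. t * k)"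
      by (simp add: image_image mult.assoc)
    moreover have "range (\<lambda>t. t * k) = UNIV"
      using assms by (intro surjI[of _ "\<lambda>t. t / k"]) simp
    ultimately show ?thesis by simp
  qed
  ultimately show ?thesis unfolding feet_def by simp
qed

lemma eventually_quadratic_nonzero:
  fixes c0 c1 c2 :: real
  assumes "c0 \<noteq> 0 \<or> c1 \<noteq> 0 \<or> c2 \<noteq> 0"
  shows "\<forall>\<^sub>F e in at 0. c0 + c1 * e + c2 * e^2 \<noteq> 0"
proof -
  let ?p = "[:c0, c1, c2:]"
  have "finite {e. poly ?p e = 0}" using assms by (intro poly_roots_finite) auto
  then have "\<forall>\<^sub>F e in at 0. e \<notin> {e. poly ?p e = 0}"
    using islimpt_finite islimpt_iff_eventually by blast
  then show ?thesis
    by (rule eventually_mono) (simp add: algebra_simps power2_eq_square)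
qed

section \<open>The conic and its dual in homogeneous coordinates\<close>

locale conic_equation =
  fixes a11 a22 a12 a1 a2 c :: real
begin

text \<open>
  \<open>T1\<close>, \<open>T2\<close>, \<open>T3\<close> are the coefficients of the tangent (the polar line) of \<open>(p : q : s)\<close>, that is,
  the components of \<open>M P\<close>.
\<close>

abbreviation "T1 p q s \<equiv> a11 * p + a12 * q + a1 * s"
abbreviation "T2 p q s \<equiv> a12 * p + a22 * q + a2 * s"
abbreviation "T3 p q s \<equiv> a1 * p + a2 * q + c * s"
abbreviation "disc \<equiv> conic_disc a11 a22 a12 a1 a2 c"
abbreviation "locus \<equiv> pedal_locus a11 a22 a12 a1 a2 c"
abbreviation "tangent_feet p q s \<equiv> feet (T1 p q s) (T2 p q s) (T3 p q s)"

definition hform :: "real \<Rightarrow> real \<Rightarrow> real \<Rightarrow> real" where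
  "hform p q s = p * T1 p q s + q * T2 p q s + s * T3 p q s"

definition dual_form :: "real \<Rightarrow> real \<Rightarrow> real \<Rightarrow> real" where
  "dual_form l m n =
     (a22 * c - a2^2) * l^2 + (a11 * c - a1^2) * m^2 + (a11 * a22 - a12^2) * n^2
     + 2 * (a1 * a2 - a12 * c) * l * m + 2 * (a12 * a2 - a1 * a22) * l * n
     + 2 * (a12 * a1 - a11 * a2) * m * n"

text \<open>
  The line with coefficients \<open>(x, y, - (x\<^sup>2 + y\<^sup>2))\<close> is the one through \<open>(x, y)\<close> perpendicular to the
  radius vector. This identity is the reason for the shape of \<open>G1\<close>.
\<close>

lemma G1_eq_dual_form: "G1 a11 a22 a12 a1 a2 c x y = - dual_form x y (- (x^2 + y^2))"
  unfolding G1_def dual_form_def by algebra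

lemma dual_form_tangent: "dual_form (T1 p q s) (T2 p q s) (T3 p q s) = disc * hform p q s"
  unfolding dual_form_def hform_def conic_disc_eq by algebra

lemma tangent_nonzero:
  assumes "disc \<noteq> 0" "T1 p q s = 0" "T2 p q s = 0" "T3 p q s = 0"
  shows "p = 0 \<and> q = 0 \<and> s = 0"
proof -
  have "disc * p = 0" "disc * q = 0" "disc * s = 0"
    using assms(2-) unfolding conic_disc_eq by algebra+
  with assms(1) show ?thesis by simp
qed

text \<open>
  The only line without a direction is the line at infinity, and it has no foot.
\<close>

lemma tangent_direction_nonzero:
  assumes "disc \<noteq> 0" "(p, q, s) \<noteq> (0, 0, 0)" "z \<in> tangent_feet p q s"
  shows "(T1 p q s, T2 p q s) \<noteq> (0, 0)"
proof
  assume 0: "(T1 p q s, T2 p q s) = (0, 0)"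
  then have "z \<in> line 0 0 (T3 p q s)" using assms(3) by (auto simp: feet_def)
  then have "T3 p q s = 0" by (simp add: line_def split: if_splits)
  with 0 tangent_nonzero[of p q s] assms(1,2) show False by auto
qed

text \<open>
  \<open>C1\<close>, \<open>C2\<close>, \<open>C3\<close> are the components of the adjugate of \<open>M\<close> applied to a line: the homogeneous
  coordinates of its pole, which is the point of contact if the line is a tangent.
\<close>

abbreviation "C1 l m n \<equiv> (a22 * c - a2^2) * l + (a1 * a2 - a12 * c) * m + (a12 * a2 - a1 * a22) * n"
abbreviation "C2 l m n \<equiv> (a1 * a2 - a12 * c) * l + (a11 * c - a1^2) * m + (a12 * a1 - a11 * a2) * n"
abbreviation "C3 l m n \<equiv> (a12 * a2 - a1 * a22) * l + (a12 * a1 - a11 * a2) * m + (a11 * a22 - a12^2) * n"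

lemma tangent_pole:
  "T1 (C1 l m n) (C2 l m n) (C3 l m n) = disc * l"
  "T2 (C1 l m n) (C2 l m n) (C3 l m n) = disc * m"
  "T3 (C1 l m n) (C2 l m n) (C3 l m n) = disc * n"
  unfolding conic_disc_eq by algebra+

lemma dual_form_eq_pole: "dual_form l m n = l * C1 l m n + m * C2 l m n + n * C3 l m n"
  unfolding dual_form_def by algebra

lemma hform_pole: "hform (C1 l m n) (C2 l m n) (C3 l m n) = disc * dual_form l m n"
  unfolding hform_def tangent_pole dual_form_eq_pole by algebra

text \<open>
  The polars of two points meet in the pole of the line joining the points; in coordinates, the
  adjugate of \<open>M\<close> turns cross products of vectors into cross products of their images under \<open>M\<close>.
\<close>

lemma pole_of_join:
  "T2 p q s * T3 x y z - T3 p q s * T2 x y z = C1 (q * z - s * y) (s * x - p * z) (p * y - q * x)"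
  "T3 p q s * T1 x y z - T1 p q s * T3 x y z = C2 (q * z - s * y) (s * x - p * z) (p * y - q * x)"
  "T1 p q s * T2 x y z - T2 p q s * T1 x y z = C3 (q * z - s * y) (s * x - p * z) (p * y - q * x)"
  by algebra+

text \<open>
  The dual form at the line joining two points is their Gram determinant with respect to the
  quadratic form.
\<close>

lemma dual_form_join:
  "dual_form (q * z - s * y) (s * x - p * z) (p * y - q * x) =
     hform p q s * hform x y z - (T1 p q s * x + T2 p q s * y + T3 p q s * z)^2"
  unfolding dual_form_eq_pole pole_of_join[symmetric] hform_def by algebra

text \<open>
  The line joining a point \<open>P\<close> of the conic with any point \<open>X\<close> meets the conic again in
  \<open>hform X * P - 2 B(P, X) * X\<close>, where \<open>B\<close> is the polar form.
\<close>

lemma hform_second_intersection: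
  fixes p q s x y z :: real
  defines "a \<equiv> hform x y z" and "b \<equiv> 2 * (T1 p q s * x + T2 p q s * y + T3 p q s * z)"
  assumes "hform p q s = 0"
  shows "hform (a * p - b * x) (a * q - b * y) (a * s - b * z) = 0"
proof -
  have "hform (a * p - b * x) (a * q - b * y) (a * s - b * z) =
      a^2 * hform p q s - a * b * b + b^2 * hform x y z" for a
    unfolding hform_def b_def by algebra
  then show ?thesis using assms(3) by (simp add: a_def power2_eq_square)
qed

lemma hform_divide: "hform (x / k) (y / k) (z / k) = hform x y z / k^2"
  unfolding hform_def divide_inverse power_inverse[symmetric] by algebra

section \<open>The zero set of G1\<close>

lemma mem_locus_iff:
  "z \<in> locus \<longleftrightarrow> (\<exists>p q s. s \<noteq> 0 \<and> hform p q s = 0 \<and> z \<in> tangent_feet p q s)"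
proof
  assume "z \<in> locus"
  then obtain x y where "(x, y) \<in> conic a11 a22 a12 a1 a2 c"
    "z \<in> feet (a1 + a11 * x + a12 * y) (a2 + a12 * x + a22 * y) (c + a1 * x + a2 * y)"
    unfolding pedal_locus_def by blast
  then have "hform x y 1 = 0 \<and> z \<in> tangent_feet x y 1"
    unfolding conic_def hform_def by (simp add: algebra_simps power2_eq_square)
  then show "\<exists>p q s. s \<noteq> 0 \<and> hform p q s = 0 \<and> z \<in> tangent_feet p q s"
    using zero_neq_one by metis
next
  assume "\<exists>p q s. s \<noteq> 0 \<and> hform p q s = 0 \<and> z \<in> tangent_feet p q s"
  then obtain p q s where s: "s \<noteq> 0" and h: "hform p q s = 0" and z: "z \<in> tangent_feet p q s"
    by blast
  define x y where "x = p / s" and "y = q / s"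
  have p: "p = s * x" and q: "q = s * y" using s by (simp_all add: x_def y_def)
  have "s^2 * (a11 * x^2 + a22 * y^2 + 2 * a12 * x * y + 2 * a1 * x + 2 * a2 * y + c) = 0"
    using h unfolding hform_def p q by algebra
  then have "(x, y) \<in> conic a11 a22 a12 a1 a2 c" using s by (simp add: conic_def)
  moreover have "tangent_feet p q s
      = feet (s * (a1 + a11 * x + a12 * y)) (s * (a2 + a12 * x + a22 * y)) (s * (c + a1 * x + a2 * y))"
    unfolding p q by (simp add: algebra_simps)
  then have "z \<in> feet (a1 + a11 * x + a12 * y) (a2 + a12 * x + a22 * y) (c + a1 * x + a2 * y)"
    using z feet_scale[OF s] by simp
  ultimately show "z \<in> locus" unfolding pedal_locus_def by blast
qed

lemma mem_locusI:
  assumes "s \<noteq> 0" "hform p q s = 0" "z \<in> tangent_feet p q s"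
  shows "z \<in> locus"
  using assms mem_locus_iff by blast

lemma mem_asymptote_feet_iff:
  "z \<in> asymptote_feet a11 a22 a12 a1 a2 \<longleftrightarrow>
     (\<exists>p q. (p, q) \<noteq> (0, 0) \<and> hform p q 0 = 0 \<and> z \<in> tangent_feet p q 0)"
proof -
  have "hform p q 0 = a11 * p^2 + a22 * q^2 + 2 * a12 * p * q" for p q
    unfolding hform_def by algebra
  then show ?thesis unfolding asymptote_feet_def by auto
qed

text \<open>
  Seen projectively, the locus and the feet of the asymptotes are a single object.
\<close>

lemma projective_locus:
  "locus \<union> asymptote_feet a11 a22 a12 a1 a2 =
     {z. \<exists>p q s. (p, q, s) \<noteq> (0, 0, 0) \<and> hform p q s = 0 \<and> z \<in> tangent_feet p q s}"
  (is "_ = {z. ?R z}")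
proof (rule set_eqI)
  fix z
  have "?R z \<longleftrightarrow> (\<exists>p q s. s \<noteq> 0 \<and> hform p q s = 0 \<and> z \<in> tangent_feet p q s) \<or>
     (\<exists>p q. (p, q) \<noteq> (0, 0) \<and> hform p q 0 = 0 \<and> z \<in> tangent_feet p q 0)"
    (is "_ \<longleftrightarrow> ?A \<or> ?B")
  proof
    assume "?R z"
    then obtain p q s where *: "(p, q, s) \<noteq> (0, 0, 0)" "hform p q s = 0" "z \<in> tangent_feet p q s"
      by blast
    show "?A \<or> ?B"
    proof (cases "s = 0")
      case True
      with * have "(p, q) \<noteq> (0, 0)" "hform p q 0 = 0" "z \<in> tangent_feet p q 0" by auto
      then show ?thesis by blast
    next
      case False
      with * show ?thesis by blast
    qed
  next
    assume "?A \<or> ?B"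
    then show "?R z" by (metis Pair_inject)
  qed
  then show "z \<in> locus \<union> asymptote_feet a11 a22 a12 a1 a2 \<longleftrightarrow> z \<in> {z. ?R z}"
    by (simp only: Un_iff mem_locus_iff mem_asymptote_feet_iff mem_Collect_eq)
qed

text \<open>
  A nonzero zero of \<open>G1\<close> determines a line of the dual conic, and the pole of that line is a point of
  contact. Conversely, a foot on a tangent determines the tangent up to a factor.
\<close>

lemma G1_zero_set:
  assumes "disc \<noteq> 0"
  shows "{(x, y). G1 a11 a22 a12 a1 a2 c x y = 0} =
    insert (0, 0) (locus \<union> asymptote_feet a11 a22 a12 a1 a2)"
proof (intro equalityI subsetI)
  fix z assume "z \<in> {(x, y). G1 a11 a22 a12 a1 a2 c x y = 0}"
  then obtain x y where z: "z = (x, y)" and G: "G1 a11 a22 a12 a1 a2 c x y = 0" by blast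
  show "z \<in> insert (0, 0) (locus \<union> asymptote_feet a11 a22 a12 a1 a2)"
  proof (cases "z = (0, 0)")
    case False
    then have "(x, y, - (x^2 + y^2)) \<noteq> (0, 0, 0)" using z by auto
    then have xyr: "(disc * x, disc * y, disc * - (x^2 + y^2)) \<noteq> (0, 0, 0)" using assms by auto
    \<comment> \<open>the pole of the perpendicular through (x, y), at which that line touches the conic\<close>
    define p q s where "p = C1 x y (- (x^2 + y^2))" and "q = C2 x y (- (x^2 + y^2))"
      and "s = C3 x y (- (x^2 + y^2))"
    have T: "T1 p q s = disc * x" "T2 p q s = disc * y" "T3 p q s = disc * - (x^2 + y^2)"
      unfolding p_def q_def s_def by (rule tangent_pole)+
    with xyr have nz: "(p, q, s) \<noteq> (0, 0, 0)" by auto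
    have "hform p q s = disc * dual_form x y (- (x^2 + y^2))"
      unfolding p_def q_def s_def by (rule hform_pole)
    then have "hform p q s = 0" using G by (simp add: G1_eq_dual_form)
    moreover have "(x, y) \<in> tangent_feet p q s"
    proof -
      have "(x, y) \<in> line x y (- (x^2 + y^2))" by (simp add: line_def power2_eq_square)
      moreover have "(x, y) = (1 * x, 1 * y)" by simp
      then have "(x, y) \<in> range (\<lambda>t. (t * x, t * y))" by blast
      ultimately show ?thesis unfolding T feet_scale[OF assms] by (simp add: feet_def)
    qed
    ultimately show ?thesis unfolding projective_locus z using nz by blast
  qed simp
next
  fix z assume "z \<in> insert (0, 0) (locus \<union> asymptote_feet a11 a22 a12 a1 a2)"
  moreover have "G1 a11 a22 a12 a1 a2 c x y = 0"
    if h: "hform p q s = 0" and z: "(x, y) \<in> tangent_feet p q s" for x y p q s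
  proof -
    obtain t where x: "x = t * T1 p q s" and y: "y = t * T2 p q s"
      and l: "T1 p q s * x + T2 p q s * y + T3 p q s = 0"
      using z by (auto simp: feet_def line_def)
    have "- (x^2 + y^2) = - t * (T1 p q s * x + T2 p q s * y)"
      unfolding x y by algebra
    then have w: "- (x^2 + y^2) = t * T3 p q s" using l by algebra
    have "dual_form x y (- (x^2 + y^2)) = t^2 * dual_form (T1 p q s) (T2 p q s) (T3 p q s)"
      unfolding w unfolding x y dual_form_def by algebra
    then show ?thesis by (simp add: G1_eq_dual_form dual_form_tangent h)
  qed
  moreover have "G1 a11 a22 a12 a1 a2 c 0 0 = 0" by (simp add: G1_def)
  ultimately show "z \<in> {(x, y). G1 a11 a22 a12 a1 a2 c x y = 0}"
    unfolding projective_locus by (cases z) auto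
qed

section \<open>Approaching a point along the conic\<close>

text \<open>
  Let \<open>t = M P\<close>. The curve consists of the second intersections of the conic with the lines joining
  \<open>P\<close> to \<open>R + e t\<close>, where \<open>R = t \<times> M t\<close> lies on the tangent at \<open>P\<close>. At \<open>e = 0\<close> the joining line
  is that tangent, so the second intersection is \<open>P\<close> itself. The curve is quadratic in \<open>e\<close>, and
  \<open>P\<close>, \<open>R\<close>, \<open>t\<close> form a basis, so that a linear form which vanishes along the whole curve is zero.
\<close>

lemma conic_branch:
  assumes disc: "disc \<noteq> 0" and nz: "(p, q, s) \<noteq> (0, 0, 0)" and h: "hform p q s = 0"
    and form: "(l, m, n) \<noteq> (0, 0, 0)"
  obtains f g h :: "real \<Rightarrow> real" where "f \<midarrow>0\<rightarrow> p" "g \<midarrow>0\<rightarrow> q" "h \<midarrow>0\<rightarrow> s"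
    "\<forall>e. hform (f e) (g e) (h e) = 0"
    "\<forall>\<^sub>F e in at 0. l * f e + m * g e + n * h e \<noteq> 0"
proof -
  define u v w where "u = T1 p q s" and "v = T2 p q s" and "w = T3 p q s"
  define u' v' w' where "u' = T1 u v w" and "v' = T2 u v w" and "w' = T3 u v w"
  define r1 r2 r3 where "r1 = v * w' - w * v'" and "r2 = w * u' - u * w'" and "r3 = u * v' - v * u'"
  define \<beta> where "\<beta> = u^2 + v^2 + w^2"
  define \<kappa> where "\<kappa> = hform r1 r2 r3"
  define \<mu> where "\<mu> = r1 * u' + r2 * v' + r3 * w'"
  have "\<not> (u = 0 \<and> v = 0 \<and> w = 0)"
    using tangent_nonzero[OF disc, of p q s] nz unfolding u_def v_def w_def by auto
  then have \<beta>: "\<beta> \<noteq> 0"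
    unfolding \<beta>_def by (smt (verit) zero_less_power2 zero_le_power2)
  \<comment> \<open>R is the pole of the line joining P and t, so that its form is a multiple of the dual form there\<close>
  have r: "r1 = C1 (q * w - s * v) (s * u - p * w) (p * v - q * u)"
    "r2 = C2 (q * w - s * v) (s * u - p * w) (p * v - q * u)"
    "r3 = C3 (q * w - s * v) (s * u - p * w) (p * v - q * u)"
    unfolding r1_def r2_def r3_def u'_def v'_def w'_def pole_of_join[symmetric]
    by (simp_all only: u_def v_def w_def)
  have dual: "dual_form (q * w - s * v) (s * u - p * w) (p * v - q * u) = - (\<beta>^2)"
    unfolding dual_form_join h u_def[symmetric] v_def[symmetric] w_def[symmetric] \<beta>_def
    by (simp add: power2_eq_square)
  have "\<kappa> = disc * - (\<beta>^2)" unfolding \<kappa>_def r hform_pole dual ..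
  then have \<kappa>: "\<kappa> \<noteq> 0" using disc \<beta> by simp
  define R where "R e = hform (r1 + e * u) (r2 + e * v) (r3 + e * w)" for e
  \<comment> \<open>division by the value at 0 of the factor of P makes the limit P itself and not a multiple\<close>
  define f where "f e = (R e * p - 2 * (e * \<beta>) * (r1 + e * u)) / \<kappa>" for e
  define g where "g e = (R e * q - 2 * (e * \<beta>) * (r2 + e * v)) / \<kappa>" for e
  define k where "k e = (R e * s - 2 * (e * \<beta>) * (r3 + e * w)) / \<kappa>" for e
  have R: "R e = \<kappa> + 2 * \<mu> * e + hform u v w * e^2" for e
    unfolding R_def \<kappa>_def \<mu>_def u'_def v'_def w'_def hform_def by algebra
  have lim: "f \<midarrow>0\<rightarrow> p" "g \<midarrow>0\<rightarrow> q" "k \<midarrow>0\<rightarrow> s"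
    unfolding f_def g_def k_def R using \<kappa> by (auto intro!: tendsto_eq_intros)
  have polar: "T1 p q s * (r1 + e * u) + T2 p q s * (r2 + e * v) + T3 p q s * (r3 + e * w) = e * \<beta>" for e
    unfolding u_def[symmetric] v_def[symmetric] w_def[symmetric] r1_def r2_def r3_def \<beta>_def by algebra
  have on: "hform (f e) (g e) (k e) = 0" for e
    using hform_second_intersection[OF h, of "r1 + e * u" "r2 + e * v" "r3 + e * w"]
    unfolding f_def g_def k_def hform_divide R_def polar by simp
  have "\<forall>\<^sub>F e in at 0. l * f e + m * g e + n * k e \<noteq> 0"
  proof -
    define lP lR lS where "lP = l * p + m * q + n * s" and "lR = l * r1 + m * r2 + n * r3"
      and "lS = l * u + m * v + n * w"
    have eq: "l * f e + m * g e + n * k e =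
        (\<kappa> * lP + (2 * \<mu> * lP - 2 * \<beta> * lR) * e + (hform u v w * lP - 2 * \<beta> * lS) * e^2) / \<kappa>" for e
      unfolding f_def g_def k_def R lP_def lR_def lS_def divide_inverse by algebra
    have "\<not> (\<kappa> * lP = 0 \<and> 2 * \<mu> * lP - 2 * \<beta> * lR = 0 \<and> hform u v w * lP - 2 * \<beta> * lS = 0)"
    proof
      assume "\<kappa> * lP = 0 \<and> 2 * \<mu> * lP - 2 * \<beta> * lR = 0 \<and> hform u v w * lP - 2 * \<beta> * lS = 0"
      then have 0: "lP = 0" "lR = 0" "lS = 0" using \<kappa> \<beta> by auto
      \<comment> \<open>the determinant of P, t and R, to be used in Cramer's rule\<close>
      define d where "d = (q * w - s * v) * r1 + (s * u - p * w) * r2 + (p * v - q * u) * r3"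
      have "d * l = 0" "d * m = 0" "d * n = 0"
        using 0 unfolding d_def lP_def lR_def lS_def by algebra+
      moreover have "d = - (\<beta>^2)"
        unfolding d_def r dual_form_eq_pole[symmetric] dual ..
      ultimately show False using form \<beta> by auto
    qed
    then show ?thesis
      using eventually_quadratic_nonzero \<kappa> unfolding eq by simp
  qed
  then show ?thesis by (rule that[OF lim allI[OF on]])
qed

text \<open>
  The foot on the tangent at a point of the projective conic is a continuous function of the point,
  as long as the tangent is not the line at infinity.
\<close>

lemma foot_curve:
  assumes disc: "disc \<noteq> 0" and nz: "(p, q, s) \<noteq> (0, 0, 0)" and h: "hform p q s = 0"
    and z: "z \<in> tangent_feet p q s" and form: "(l, m, n) \<noteq> (0, 0, 0)"
  obtains f g h :: "real \<Rightarrow> real" and Z where "h \<midarrow>0\<rightarrow> s" "Z \<midarrow>0\<rightarrow> z"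
    "\<forall>e. hform (f e) (g e) (h e) = 0"
    "\<forall>\<^sub>F e in at 0. l * f e + m * g e + n * h e \<noteq> 0"
    "\<forall>\<^sub>F e in at 0. Z e \<in> tangent_feet (f e) (g e) (h e)"
proof -
  obtain f g k :: "real \<Rightarrow> real" where lim: "f \<midarrow>0\<rightarrow> p" "g \<midarrow>0\<rightarrow> q" "k \<midarrow>0\<rightarrow> s"
    and on: "\<forall>e. hform (f e) (g e) (k e) = 0"
    and ev: "\<forall>\<^sub>F e in at 0. l * f e + m * g e + n * k e \<noteq> 0"
    by (rule conic_branch[OF disc nz h form]) (rule that)
  define U V W where "U e = T1 (f e) (g e) (k e)" and "V e = T2 (f e) (g e) (k e)"
    and "W e = T3 (f e) (g e) (k e)" for e
  define Z where "Z e = (- W e / (U e^2 + V e^2) * U e, - W e / (U e^2 + V e^2) * V e)" for e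
  have dir: "(T1 p q s, T2 p q s) \<noteq> (0, 0)"
    using tangent_direction_nonzero[OF disc nz z] .
  then have N: "(T1 p q s)^2 + (T2 p q s)^2 \<noteq> 0" by (simp add: sum_power2_eq_zero_iff)
  have limT: "U \<midarrow>0\<rightarrow> T1 p q s" "V \<midarrow>0\<rightarrow> T2 p q s" "W \<midarrow>0\<rightarrow> T3 p q s"
    unfolding U_def V_def W_def
    by (intro tendsto_add tendsto_mult_left lim)+
  have lim_foot: "Z \<midarrow>0\<rightarrow> (- T3 p q s / ((T1 p q s)^2 + (T2 p q s)^2) * T1 p q s,
      - T3 p q s / ((T1 p q s)^2 + (T2 p q s)^2) * T2 p q s)"
    unfolding Z_def
    by (intro tendsto_Pair tendsto_mult tendsto_divide tendsto_minus tendsto_add tendsto_power limT N)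
  have foot: "z = (- T3 p q s / ((T1 p q s)^2 + (T2 p q s)^2) * T1 p q s,
      - T3 p q s / ((T1 p q s)^2 + (T2 p q s)^2) * T2 p q s)"
    using z unfolding feet_eq[OF dir] by (rule singletonD)
  have "Z \<midarrow>0\<rightarrow> z" by (subst foot) (fact lim_foot)
  moreover have "\<forall>\<^sub>F e in at 0. Z e \<in> tangent_feet (f e) (g e) (k e)"
  proof -
    have "((\<lambda>e. U e^2 + V e^2) \<longlongrightarrow> (T1 p q s)^2 + (T2 p q s)^2) (at 0)"
      by (intro tendsto_intros limT)
    then have "\<forall>\<^sub>F e in at 0. U e^2 + V e^2 \<noteq> 0"
      using N tendsto_imp_eventually_ne by blast
    then show ?thesis
    proof (rule eventually_mono)
      fix e assume "U e^2 + V e^2 \<noteq> 0"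
      then have "(U e, V e) \<noteq> (0, 0)" by auto
      then show "Z e \<in> tangent_feet (f e) (g e) (k e)"
        using feet_eq[of "U e" "V e" "W e"] by (simp add: Z_def U_def V_def W_def)
    qed
  qed
  ultimately show ?thesis
    by (rule that[OF lim(3) _ on ev])
qed

section \<open>The completed pedal and its isolated points\<close>

lemma asymptote_feet_subset_closure:
  assumes "disc \<noteq> 0"
  shows "asymptote_feet a11 a22 a12 a1 a2 \<subseteq> closure locus"
proof
  fix z assume "z \<in> asymptote_feet a11 a22 a12 a1 a2"
  then obtain p q where nz: "(p, q) \<noteq> (0, 0)" and h: "hform p q 0 = 0" and z: "z \<in> tangent_feet p q 0"
    unfolding mem_asymptote_feet_iff by blast
  from nz have "(p, q, 0) \<noteq> (0, 0, 0::real)" by simp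
  \<comment> \<open>the form to be avoided is the last coordinate, so that the approximating points are affine\<close>
  moreover have "(0, 0, 1) \<noteq> (0, 0, 0::real)" by simp
  ultimately obtain f g h Z where "h \<midarrow>0\<rightarrow> 0" and Z: "Z \<midarrow>0\<rightarrow> z" and on: "\<forall>e. hform (f e) (g e) (h e) = 0"
    and fin: "\<forall>\<^sub>F e in at 0. 0 * f e + 0 * g e + 1 * h e \<noteq> (0::real)"
    and foot: "\<forall>\<^sub>F e in at (0::real). Z e \<in> tangent_feet (f e) (g e) (h e)"
    by (rule foot_curve[OF assms _ h z]) (rule that)
  have "\<forall>\<^sub>F e in at 0. Z e \<in> closure locus"
    using fin foot
  proof eventually_elim
    case (elim e)
    then have "Z e \<in> locus" using on by (intro mem_locusI[of "h e" "f e" "g e"]) simp_all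
    then show ?case by (rule subsetD[OF closure_subset])
  qed
  then show "z \<in> closure locus"
    by (rule Lim_in_closed_set[OF closed_closure _ _ Z]) (rule at_neq_bot)
qed

text \<open>
  The origin is the foot exactly for the tangents through the origin. Their points of contact lie on
  the polar of the origin, \<open>T3 = 0\<close>, and the approximating points are chosen off this line.
\<close>

lemma origin_limit_of_locus:
  assumes disc: "disc \<noteq> 0" and "(0, 0) \<in> locus"
  shows "(0, 0) islimpt locus"
proof -
  obtain p q s where s: "s \<noteq> 0" and h: "hform p q s = 0" and 0: "(0, 0) \<in> tangent_feet p q s"
    using assms(2) mem_locus_iff by blast
  then have nz: "(p, q, s) \<noteq> (0, 0, 0)" by simp
  have row: "(a1, a2, c) \<noteq> (0, 0, 0)" using disc by (auto simp: conic_disc_eq)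
  obtain f g k Z where k: "k \<midarrow>0\<rightarrow> s" and Z: "Z \<midarrow>0\<rightarrow> (0, 0)"
    and on: "\<forall>e. hform (f e) (g e) (k e) = 0"
    and off: "\<forall>\<^sub>F e in at 0. T3 (f e) (g e) (k e) \<noteq> 0"
    and foot: "\<forall>\<^sub>F e in at (0::real). Z e \<in> tangent_feet (f e) (g e) (k e)"
    by (rule foot_curve[OF disc nz h 0 row]) (rule that)
  have "\<forall>\<^sub>F e in at 0. k e \<noteq> 0" by (rule tendsto_imp_eventually_ne[OF k s])
  with off foot have "\<forall>\<^sub>F e in at 0. Z e \<in> locus - {(0, 0)}"
  proof eventually_elim
    case (elim e)
    then have "Z e \<in> locus" using on by (intro mem_locusI[of "k e" "f e" "g e"]) simp_all
    moreover have "Z e \<in> line (T1 (f e) (g e) (k e)) (T2 (f e) (g e) (k e)) (T3 (f e) (g e) (k e))"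
      using elim(2) unfolding feet_def by (rule IntD1)
    then have "Z e \<noteq> (0, 0)" using elim(1) unfolding line_def by fastforce
    ultimately show ?case by simp
  qed
  then have "\<forall>\<^sub>F e in at 0. Z e \<in> closure (locus - {(0, 0)})"
    by (rule eventually_mono) (rule subsetD[OF closure_subset])
  then have "(0, 0) \<in> closure (locus - {(0, 0)})"
    by (rule Lim_in_closed_set[OF closed_closure _ _ Z]) (rule at_neq_bot)
  then show ?thesis by (simp add: islimpt_in_closure)
qed

lemma pedal_eq:
  assumes "disc \<noteq> 0"
  shows "pedal a11 a22 a12 a1 a2 c = {(x, y). G1 a11 a22 a12 a1 a2 c x y = 0}"
proof -
  have "closed {z. G1 a11 a22 a12 a1 a2 c (fst z) (snd z) = 0}"
    unfolding G1_def by (intro closed_Collect_eq continuous_intros)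
  then have "closed {(x, y). G1 a11 a22 a12 a1 a2 c x y = 0}"
    by (simp add: case_prod_unfold)
  then have "closure locus \<subseteq> {(x, y). G1 a11 a22 a12 a1 a2 c x y = 0}"
    unfolding G1_zero_set[OF assms] by (intro closure_minimal) auto
  then show ?thesis
    using asymptote_feet_subset_closure[OF assms] closure_subset[of locus]
    unfolding pedal_def G1_zero_set[OF assms] by blast
qed

text \<open>
  The limit points of the pedal are those of the locus, since taking the closure and adding one point
  do not change them. So only a point of the locus itself could violate the equivalence.
\<close>

lemma origin_isolated_iff:
  assumes "disc \<noteq> 0"
  shows "(0, 0) isolated_in pedal a11 a22 a12 a1 a2 c \<longleftrightarrow> (0, 0) \<notin> closure locus"
proof -
  have "(0, 0) isolated_in pedal a11 a22 a12 a1 a2 c \<longleftrightarrow> \<not> (0, 0) islimpt pedal a11 a22 a12 a1 a2 c"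
    by (simp add: isolated_in_islimpt_iff pedal_def)
  also have "(0, 0) islimpt pedal a11 a22 a12 a1 a2 c \<longleftrightarrow> (0, 0) islimpt locus"
    by (simp add: pedal_def islimpt_insert limpt_of_closure)
  also have "\<dots> \<longleftrightarrow> (0, 0) \<in> closure locus"
    using origin_limit_of_locus[OF assms] by (auto simp: closure_def)
  finally show ?thesis .
qed

section \<open>The degree of G1\<close>

lemma G1_degree:
  assumes "disc \<noteq> 0"
  shows "poly2_of_degree (G1 a11 a22 a12 a1 a2 c) (if a12^2 = a11 * a22 then 3 else 4)"
proof -
  define D E F where "D = a12^2 - a11 * a22" and "E = 2 * (a12 * a2 - a1 * a22)"
    and "F = 2 * (a1 * a12 - a2 * a11)"
  define K where "K i j =
    (if (i, j) \<in> {(4, 0), (0, 4)} then D else if (i, j) = (2, 2) then 2 * D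
     else if (i, j) \<in> {(3, 0), (1, 2)} then E else if (i, j) \<in> {(2, 1), (0, 3)} then F
     else if (i, j) = (2, 0) then a2^2 - a22 * c
     else if (i, j) = (1, 1) then 2 * (a12 * c - a1 * a2)
     else if (i, j) = (0, 2) then a1^2 - a11 * c else 0)" for i j :: nat
  show ?thesis
  proof (cases "a12^2 = a11 * a22")
    case True
    then have D: "D = 0" by (simp add: D_def)
    have "2 * disc = a1 * E + a2 * F - 2 * c * D"
      unfolding conic_disc_eq D_def E_def F_def by algebra
    then have "E \<noteq> 0 \<or> F \<noteq> 0" using assms D by auto
    then have "\<exists>i\<le>3. K i (3 - i) \<noteq> 0"
    proof
      assume "E \<noteq> 0" then show ?thesis by (intro exI[of _ 3]) (simp add: K_def)
    next
      assume "F \<noteq> 0" then show ?thesis by (intro exI[of _ 0]) (simp add: K_def)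
    qed
    moreover have "G1 a11 a22 a12 a1 a2 c x y = (\<Sum>i\<le>3. \<Sum>j\<le>3 - i. K i j * x^i * y^j)" for x y
    proof -
      have "(\<Sum>i\<le>3. \<Sum>j\<le>3 - i. K i j * x^i * y^j) = E * x^3 + E * (x * y^2) + F * (x^2 * y)
         + F * y^3 + (a2^2 - a22 * c) * x^2 + 2 * (a12 * c - a1 * a2) * x * y + (a1^2 - a11 * c) * y^2"
        by (simp add: K_def numeral_eq_Suc)
      also have "\<dots> = G1 a11 a22 a12 a1 a2 c x y"
        using D unfolding G1_def E_def F_def D_def by algebra
      finally show ?thesis by simp
    qed
    ultimately show ?thesis using True unfolding poly2_of_degree_def by auto
  next
    case False
    then have "\<exists>i\<le>4. K i (4 - i) \<noteq> 0"
      by (intro exI[of _ 4]) (simp add: K_def D_def)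
    moreover have "G1 a11 a22 a12 a1 a2 c x y = (\<Sum>i\<le>4. \<Sum>j\<le>4 - i. K i j * x^i * y^j)" for x y
    proof -
      have "(\<Sum>i\<le>4. \<Sum>j\<le>4 - i. K i j * x^i * y^j) = D * x^4 + 2 * D * (x^2 * y^2) + D * y^4
         + E * x^3 + E * (x * y^2) + F * (x^2 * y)
         + F * y^3 + (a2^2 - a22 * c) * x^2 + 2 * (a12 * c - a1 * a2) * x * y + (a1^2 - a11 * c) * y^2"
        by (simp add: K_def numeral_eq_Suc)
      also have "\<dots> = G1 a11 a22 a12 a1 a2 c x y"
        unfolding G1_def E_def F_def D_def by algebra
      finally show ?thesis by simp
    qed
    ultimately show ?thesis using False unfolding poly2_of_degree_def by auto
  qed
qed

end

theorem proposition3p2: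
  fixes a11 a22 a12 a1 a2 c :: real
  assumes "irreducible_conic a11 a22 a12 a1 a2 c"
  shows "pedal a11 a22 a12 a1 a2 c = {(x, y). G1 a11 a22 a12 a1 a2 c x y = 0}
    \<and> {(x, y). G1 a11 a22 a12 a1 a2 c x y = 0} =
        insert (0, 0) (pedal_locus a11 a22 a12 a1 a2 c \<union> asymptote_feet a11 a22 a12 a1 a2)
    \<and> (poly2_of_degree (G1 a11 a22 a12 a1 a2 c) 3 \<or> poly2_of_degree (G1 a11 a22 a12 a1 a2 c) 4)
    \<and> (0, 0) \<in> pedal a11 a22 a12 a1 a2 c
    \<and> ((0, 0) isolated_in pedal a11 a22 a12 a1 a2 c \<longleftrightarrow>
         (0, 0) \<notin> closure (pedal_locus a11 a22 a12 a1 a2 c))"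
proof -
  have disc: "conic_disc a11 a22 a12 a1 a2 c \<noteq> 0"
    using assms by (simp add: irreducible_conic_def)
  interpret conic_equation a11 a22 a12 a1 a2 c .
  have "poly2_of_degree (G1 a11 a22 a12 a1 a2 c) 3 \<or> poly2_of_degree (G1 a11 a22 a12 a1 a2 c) 4"
    using G1_degree[OF disc] by (auto split: if_splits)
  moreover have "(0, 0) \<in> pedal a11 a22 a12 a1 a2 c" by (simp add: pedal_def)
  ultimately show ?thesis
    using pedal_eq[OF disc] G1_zero_set[OF disc] origin_isolated_iff[OF disc] by blast
qed

end
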